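(* Let $q$ be a prime power, let $t\ge 2$, $k_1\ge 2$ and $k_2\ge 0$ be integers. If there exists a $(k_1,k_2)$-harc in $\Pi_{t-1}(q)$, then there exists an ideal secret sharing scheme of hierarchical model with $k_1+k_2-1$ participants and of strength $t$.
   Context: Projective geometry. $\Pi_r(q)$ is the projective space of dimension $r$ over $GF(q)$. Points are (linearly) independent if vectors representing them are linearly independent. A $k$-arc in $\Pi_r(q)$ is a set of $k$ points any $r+1$ of which are independent. Let $\Psi$ be a hyperplane of $\Pi_r(q)$, $\mathcal{K}_1$ a set of $k_1$ points in $\Pi_r(q)\setminus\Psi$ and $\mathcal{K}_2$ a set of $k_2$ points in $\Psi$. The set $\mathcal{K}=\mathcal{K}_1\cup\mathcal{K}_2$ is a $(k_1,k_2)$-harc (hierarchical arc) in $\Pi_r(q)$ if: (a) $\mathcal{K}_1$ is a $k_1$-arc in $\Pi_r(q)$; (b) $\mathcal{K}_2$ is a $k_2$-arc in the $(r-1)$-dimensional projective space $\Psi$; (c) any $r+1$ points of $\mathcal{K}$ not contained in $\Psi$ are independent. Secret sharing. Given finite sets $\mathcal{K}_0$ (keys), $\mathcal{S}$ (shares), $\mathcal{P}$ (participants) and a dealer $D\notin\mathcal{P}$, an access structure $\Gamma$ is a monotone (upward closed) family of subsets of $\mathcal{P}$; it is determined by its basis $\Gamma^*$, the set of its minimal members. A perfect secret sharing scheme realizing $\Gamma$ is represented by an array $M$ with rows indexed by a finite nonempty set $\mathcal{F}$ and columns indexed by $\{D\}\cup\mathcal{P}$, entries $M(f,D)\in\mathcal{K}_0$,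 $M(f,P)\in\mathcal{S}$, and $M(f,B)=(M(f,P):P\in B)$, such that: (1) if $B\in\Gamma$ and $M(f,B)=M(f',B)$ then $M(f,D)=M(f',D)$; (2) for any $B\subseteq\mathcal{P}$ with $B\notin\Gamma$ and any $f\in\mathcal{F}$, the number $|\{g\in\mathcal{F}:M(g,D)=K,\ M(g,B)=M(f,B)\}|$ is the same for every $K\in\mathcal{K}_0$. It is ideal if the information rate $\log_2|\mathcal{K}_0|/\log_2|\mathcal{S}|$ equals $1$ (so $|\mathcal{K}_0|=|\mathcal{S}|\ge2$). Hierarchical model of strength $t$: $\mathcal{P}=\mathcal{U}\cup\mathcal{L}$ is composed of two disjoint groups, the upper group $\mathcal{U}$ and the lower group $\mathcal{L}$, and $\Gamma^*=\binom{\mathcal{U}\cup\mathcal{L}}{t}\setminus\binom{\mathcal{L}}{t}$, i.e. the minimal authorized subsets are exactly the $t$-subsets of $\mathcal{P}$ containing at least one member of $\mathcal{U}$. A scheme of hierarchical model of strength $t$ is a scheme realizing such an access structure. *)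

theory Defs
  imports
    "HOL-Analysis.Cartesian_Space"
    "HOL-Number_Theory.Prime_Powers"
    "HOL-Library.Cardinality"
begin

section \<open>Arcs and hierarchical arcs in projective spaces\<close>

text \<open>
  The projective space \<open>\<Pi>\<^sub>r(q)\<close> is represented by the vector space \<open>'a ^ 'n\<close>, where \<open>'a\<close> is a field
  with \<open>q\<close> elements and \<open>CARD('n) = r + 1\<close>.  A projective subspace is represented by the
  linear subspace \<open>W\<close> that carries it, its projective dimension being \<open>vec.dim W - 1\<close>.
\<close>

definition proj_points :: "('a::field ^ 'n) set \<Rightarrow> ('a ^ 'n) set set" where
  "proj_points W = {P. vec.subspace P \<and> vec.dim P = 1 \<and> P \<subseteq> W}"

text \<open>
  Distinct points have distinct representing vectors, so passing to the image set
  \<open>v ` S\<close> does not identify any two members of the family of representatives.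
\<close>

definition indep_points :: "('a::field ^ 'n) set set \<Rightarrow> bool" where
  "indep_points S \<longleftrightarrow>
     (\<forall>v. (\<forall>P\<in>S. v P \<in> P \<and> v P \<noteq> 0) \<longrightarrow> vec.independent (v ` S))"

text \<open>The number \<open>r + 1\<close> of the projective space \<open>\<Pi>\<^sub>r\<close> carried by \<open>W\<close> is \<open>vec.dim W\<close>.\<close>

definition arc_in :: "('a::field ^ 'n) set \<Rightarrow> nat \<Rightarrow> ('a ^ 'n) set set \<Rightarrow> bool" where
  "arc_in W k K \<longleftrightarrow>
     K \<subseteq> proj_points W \<and> finite K \<and> card K = k \<and>
     (\<forall>S\<subseteq>K. card S = vec.dim W \<longrightarrow> indep_points S)"

definition hyperplane :: "('a::field ^ 'n) set \<Rightarrow> bool" where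
  "hyperplane W \<longleftrightarrow> vec.subspace W \<and> vec.dim W + 1 = CARD('n)"

definition harc :: "nat \<Rightarrow> nat \<Rightarrow> ('a::field ^ 'n) set set \<Rightarrow> bool" where
  "harc k\<^sub>1 k\<^sub>2 K \<longleftrightarrow>
     (\<exists>\<Psi> K\<^sub>1 K\<^sub>2.
        hyperplane \<Psi> \<and> K = K\<^sub>1 \<union> K\<^sub>2 \<and>
        K\<^sub>1 \<subseteq> proj_points UNIV - proj_points \<Psi> \<and>
        arc_in UNIV k\<^sub>1 K\<^sub>1 \<and> arc_in \<Psi> k\<^sub>2 K\<^sub>2 \<and>
        (\<forall>S\<subseteq>K. card S = CARD('n) \<and> \<not> S \<subseteq> proj_points \<Psi> \<longrightarrow> indep_points S))"


section \<open>Secret sharing\<close>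

definition access_structure :: "'p set \<Rightarrow> 'p set set \<Rightarrow> bool" where
  "access_structure P \<Gamma> \<longleftrightarrow>
     \<Gamma> \<subseteq> Pow P \<and> (\<forall>A B. A \<in> \<Gamma> \<and> A \<subseteq> B \<and> B \<subseteq> P \<longrightarrow> B \<in> \<Gamma>)"

definition basis :: "'p set set \<Rightarrow> 'p set set" where
  "basis \<Gamma> = {A \<in> \<Gamma>. \<forall>B\<in>\<Gamma>. B \<subseteq> A \<longrightarrow> B = A}"

text \<open>
  \<open>M\<close> is the array of the scheme, with rows \<open>F\<close> and columns \<open>insert D P\<close>; keys (\<open>K\<^sub>0\<close>) and shares
  (\<open>S\<close>) are taken from a common type of entries.
\<close>

definition perfect_scheme ::
  "'p \<Rightarrow> 'p set \<Rightarrow> 'p set set \<Rightarrow> 'v set \<Rightarrow> 'v set \<Rightarrow> 'f set \<Rightarrow> ('f \<Rightarrow> 'p \<Rightarrow> 'v) \<Rightarrow> bool"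
where
  "perfect_scheme D P \<Gamma> K\<^sub>0 S F M \<longleftrightarrow>
     finite P \<and> D \<notin> P \<and> access_structure P \<Gamma> \<and>
     finite K\<^sub>0 \<and> finite S \<and> finite F \<and> F \<noteq> {} \<and>
     (\<forall>f\<in>F. M f D \<in> K\<^sub>0 \<and> (\<forall>p\<in>P. M f p \<in> S)) \<and>
     (\<forall>B\<in>\<Gamma>. \<forall>f\<in>F. \<forall>f'\<in>F. (\<forall>p\<in>B. M f p = M f' p) \<longrightarrow> M f D = M f' D) \<and>
     (\<forall>B. B \<subseteq> P \<and> B \<notin> \<Gamma> \<longrightarrow>
        (\<forall>f\<in>F. \<forall>K\<in>K\<^sub>0. \<forall>K'\<in>K\<^sub>0.
           card {g \<in> F. M g D = K \<and> (\<forall>p\<in>B. M g p = M f p)} =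
           card {g \<in> F. M g D = K' \<and> (\<forall>p\<in>B. M g p = M f p)}))"

definition information_rate :: "'v set \<Rightarrow> 'v set \<Rightarrow> real" where
  "information_rate K\<^sub>0 S = log 2 (card K\<^sub>0) / log 2 (card S)"

text \<open>
  As \<open>log 2 0 = log 2 1 = 0\<close> and \<open>x / 0 = 0\<close>, rate \<open>1\<close> forces \<open>card K\<^sub>0 = card S \<ge> 2\<close>.
\<close>

definition ideal_scheme ::
  "'p \<Rightarrow> 'p set \<Rightarrow> 'p set set \<Rightarrow> 'v set \<Rightarrow> 'v set \<Rightarrow> 'f set \<Rightarrow> ('f \<Rightarrow> 'p \<Rightarrow> 'v) \<Rightarrow> bool"
where
  "ideal_scheme D P \<Gamma> K\<^sub>0 S F M \<longleftrightarrow>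
     perfect_scheme D P \<Gamma> K\<^sub>0 S F M \<and> information_rate K\<^sub>0 S = 1"

text \<open>
  The upper group is nonempty: otherwise no set is authorized and the model is void.  The lower
  group may be empty, which gives the threshold structure.
\<close>

definition hierarchical_model :: "nat \<Rightarrow> 'p set \<Rightarrow> 'p set \<Rightarrow> 'p set set \<Rightarrow> bool" where
  "hierarchical_model t U L \<Gamma> \<longleftrightarrow>
     U \<noteq> {} \<and> U \<inter> L = {} \<and> access_structure (U \<union> L) \<Gamma> \<and>
     basis \<Gamma> = {A. A \<subseteq> U \<union> L \<and> card A = t} - {A. A \<subseteq> L \<and> card A = t}"

end

theory Submission
  imports Defs
begin

text \<open>
  The scheme is linear.  Let \<open>w p\<close> be a vector representing the point \<open>p\<close> of the harc, let the dealer
  be a point of \<open>K\<^sub>1\<close> and the participants the remaining points, those of \<open>K\<^sub>1\<close> forming the upper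
  and those of \<open>K\<^sub>2\<close> the lower group.  The rows of the array are the linear functionals \<open>f\<close> on
  \<open>'a ^ 'n\<close>, and the entry in row \<open>f\<close> and column \<open>p\<close> is \<open>f (w p)\<close>.  Such an array determines the key
  from the shares of \<open>B\<close> if the dealer's vector lies in the span of \<open>w ` B\<close>.  If it does not, some
  functional vanishes on \<open>w ` B\<close> and takes the value \<open>1\<close> at the dealer's vector, and translating by
  its multiples shows that all keys are equally frequent (\<open>linear_scheme_perfect\<close>).

  The harc axioms say precisely which sets span the dealer's vector.  Any \<open>t\<close> points that are not
  all in the hyperplane are represented by a basis, so \<open>t\<close> participants including an upper one
  are authorized.  A set of lower participants spans a subspace of the hyperplane, which avoids the
  dealer.  Fewer than \<open>t\<close> participants together with the dealer extend to \<open>t\<close> points of the harc not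
  all in the hyperplane, hence are independent.

  This extension needs at least \<open>t\<close> points in the harc.  With fewer than \<open>t\<close> participants no set is
  authorized, the harc conditions may be void, and the array with constant zero
  shares and unrestricted key serves instead.
\<close>

section \<open>Linear secret sharing schemes\<close>

lemma perfect_schemeI:
  assumes "finite P" "D \<notin> P" "access_structure P \<Gamma>" "finite K\<^sub>0" "finite S" "finite F" "F \<noteq> {}"
    and entries: "\<forall>f\<in>F. M f D \<in> K\<^sub>0 \<and> (\<forall>p\<in>P. M f p \<in> S)"
    and recover: "\<And>B f f'. \<lbrakk>B \<in> \<Gamma>; f \<in> F; f' \<in> F; \<forall>p\<in>B. M f p = M f' p\<rbrakk> \<Longrightarrow> M f D = M f' D"
    and secret: "\<And>B f K K'. \<lbrakk>B \<subseteq> P; B \<notin> \<Gamma>; f \<in> F; K \<in> K\<^sub>0; K' \<in> K\<^sub>0\<rbrakk> \<Longrightarrow>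
      card {g \<in> F. M g D = K \<and> (\<forall>p\<in>B. M g p = M f p)} =
      card {g \<in> F. M g D = K' \<and> (\<forall>p\<in>B. M g p = M f p)}"
  shows "perfect_scheme D P \<Gamma> K\<^sub>0 S F M"
proof -
  have "\<forall>B\<in>\<Gamma>. \<forall>f\<in>F. \<forall>f'\<in>F. (\<forall>p\<in>B. M f p = M f' p) \<longrightarrow> M f D = M f' D"
    by (intro ballI impI) (rule recover)
  moreover have "\<forall>B. B \<subseteq> P \<and> B \<notin> \<Gamma> \<longrightarrow> (\<forall>f\<in>F. \<forall>K\<in>K\<^sub>0. \<forall>K'\<in>K\<^sub>0.
      card {g \<in> F. M g D = K \<and> (\<forall>p\<in>B. M g p = M f p)} =
      card {g \<in> F. M g D = K' \<and> (\<forall>p\<in>B. M g p = M f p)})"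
    by (intro allI ballI impI, elim conjE) (rule secret)
  ultimately show ?thesis
    unfolding perfect_scheme_def by (intro conjI assms(1-7) entries)
qed

lemma perfect_schemeD:
  assumes "perfect_scheme D P \<Gamma> K\<^sub>0 S F M"
  shows "finite P" "D \<notin> P" "access_structure P \<Gamma>" "finite K\<^sub>0" "finite S" "finite F" "F \<noteq> {}"
    and "\<forall>f\<in>F. M f D \<in> K\<^sub>0 \<and> (\<forall>p\<in>P. M f p \<in> S)"
    and "\<forall>B\<in>\<Gamma>. \<forall>f\<in>F. \<forall>f'\<in>F. (\<forall>p\<in>B. M f p = M f' p) \<longrightarrow> M f D = M f' D"
    and "\<forall>B. B \<subseteq> P \<and> B \<notin> \<Gamma> \<longrightarrow> (\<forall>f\<in>F. \<forall>K\<in>K\<^sub>0. \<forall>K'\<in>K\<^sub>0.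
      card {g \<in> F. M g D = K \<and> (\<forall>p\<in>B. M g p = M f p)} =
      card {g \<in> F. M g D = K' \<and> (\<forall>p\<in>B. M g p = M f p)})"
  using assms unfolding perfect_scheme_def by - (elim conjE, assumption)+

lemma vector_space_mult: "vector_space ((*) :: 'a::field \<Rightarrow> 'a \<Rightarrow> 'a)"
  by unfold_locales (simp_all add: algebra_simps)

lemma (in vector_space) functional_separating_from_span:
  assumes "v \<notin> span B"
  obtains f where "Vector_Spaces.linear scale (*) f" "\<And>b. b \<in> B \<Longrightarrow> f b = 0" "f v = 1"
proof -
  interpret pair: vector_space_pair scale "(*) :: 'a \<Rightarrow> 'a \<Rightarrow> 'a"
    by (rule vector_space_pair.intro) (rule vector_space_axioms vector_space_mult)+
  obtain C where C: "C \<subseteq> B" "independent C" "B \<subseteq> span C"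
    using maximal_independent_subset by blast
  have v: "v \<notin> span C"
    using assms span_mono[OF C(1)] by blast
  have "independent (insert v C)"
    using v C(2) by (simp add: independent_insert)
  then obtain f where f: "Vector_Spaces.linear scale (*) f"
      "\<And>x. x \<in> insert v C \<Longrightarrow> f x = (if x = v then 1 else 0)"
    using pair.linear_independent_extend[of "insert v C" "\<lambda>x. if x = v then 1 else 0"] by blast
  have "f c = 0" if "c \<in> C" for c
    using f(2)[of c] that v span_base by auto
  then have "f b = 0" if "b \<in> B" for b
    using pair.linear_eq_0_on_span[OF f(1)] C(3) that by blast
  moreover have "f v = 1"
    using f(2)[of v] by simp
  ultimately show thesis
    by (rule that[OF f(1)])
qed

text \<open>
  The hypothesis \<open>\<Gamma>\<close> says that the authorized sets are those whose vectors have the vector of the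
  dealer in their span.  Keys and shares range over the whole field.
\<close>

lemma linear_scheme_perfect:
  fixes w :: "'p \<Rightarrow> 'a::{field,finite} ^ 'n::finite"
  assumes "finite P" "D \<notin> P" "access_structure P \<Gamma>"
    and \<Gamma>: "\<And>B. B \<subseteq> P \<Longrightarrow> B \<in> \<Gamma> \<longleftrightarrow> w D \<in> vec.span (w ` B)"
  shows "perfect_scheme D P \<Gamma> UNIV UNIV {f. Vector_Spaces.linear (*s) (*) f} (\<lambda>f p. f (w p))"
proof -
  let ?F = "{f :: 'a ^ 'n \<Rightarrow> 'a. Vector_Spaces.linear (*s) (*) f}"
  interpret pair: vector_space_pair "(*s) :: 'a \<Rightarrow> 'a ^ 'n \<Rightarrow> 'a ^ 'n" "(*) :: 'a \<Rightarrow> 'a \<Rightarrow> 'a"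
    by (rule vector_space_pair.intro) (rule vec.vector_space_axioms vector_space_mult)+
  show ?thesis
  proof (rule perfect_schemeI[OF assms(1-3)])
    show "f (w D) = f' (w D)"
      if "B \<in> \<Gamma>" "f \<in> ?F" "f' \<in> ?F" "\<forall>p\<in>B. f (w p) = f' (w p)" for B f f'
    proof -
      have "B \<subseteq> P"
        using \<open>B \<in> \<Gamma>\<close> assms(3) unfolding access_structure_def by blast
      then have "w D \<in> vec.span (w ` B)"
        using \<Gamma> \<open>B \<in> \<Gamma>\<close> by blast
      then show ?thesis
        using pair.linear_eq_on[of f f' "w D" "w ` B"] that by auto
    qed
    show "card {g \<in> ?F. g (w D) = K \<and> (\<forall>p\<in>B. g (w p) = f (w p))} =
        card {g \<in> ?F. g (w D) = K' \<and> (\<forall>p\<in>B. g (w p) = f (w p))}"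
      if "B \<subseteq> P" "B \<notin> \<Gamma>" for B K K' f
    proof -
      have "w D \<notin> vec.span (w ` B)"
        using \<Gamma> that by blast
      then obtain h where h: "h \<in> ?F" "\<And>p. p \<in> B \<Longrightarrow> h (w p) = 0" "h (w D) = 1"
        by (rule vec.functional_separating_from_span) simp
      have shift: "(\<lambda>x. g x + c * h x) \<in> ?F" if "g \<in> ?F" for g c
        using that h(1) by (simp add: pair.linear_compose_add pair.linear_compose_scale_right)
      \<comment> \<open>As \<open>h\<close> vanishes on the vectors of \<open>B\<close> and is \<open>1\<close> at the dealer, adding \<open>(K' - K) h\<close> turns
        the rows with key \<open>K\<close> into rows with key \<open>K'\<close> and the same shares of \<open>B\<close>.\<close>
      let ?R = "\<lambda>K. {g \<in> ?F. g (w D) = K \<and> (\<forall>p\<in>B. g (w p) = f (w p))}"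
      have maps: "(\<lambda>g x. g x + (K' - K) * h x) ` ?R K \<subseteq> ?R K'" for K K'
        using shift h(2,3) by auto
      have inverse: "(\<lambda>x. (g x + (K' - K) * h x) + (K - K') * h x) = g" for g K K'
        by (simp add: algebra_simps)
      show ?thesis
      proof (rule bij_betw_same_card)
        show "bij_betw (\<lambda>g x. g x + (K' - K) * h x) (?R K) (?R K')"
          by (rule bij_betw_byWitness[where f' = "\<lambda>g x. g x + (K - K') * h x"])
            (intro ballI inverse maps)+
      qed
    qed
    have "(\<lambda>x. 0) \<in> ?F"
      using pair.linear_zero by simp
    then show "?F \<noteq> {}"
      by blast
  qed simp_all
qed

text \<open>
  Rows and entries may be renamed injectively; this turns functionals and field elements into
  natural numbers.
\<close>

lemma perfect_scheme_relabel:
  assumes scheme: "perfect_scheme D P \<Gamma> K\<^sub>0 S F M" and e: "inj e" and c: "inj c"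
  shows "perfect_scheme D P \<Gamma> (e ` K\<^sub>0) (e ` S) (c ` F) (\<lambda>f p. e (M (inv c f) p))"
proof (rule perfect_schemeI)
  show "finite P" "D \<notin> P" "access_structure P \<Gamma>"
    using perfect_schemeD(1-3)[OF scheme] .
  show "finite (e ` K\<^sub>0)" "finite (e ` S)" "finite (c ` F)" "c ` F \<noteq> {}"
    using perfect_schemeD(4-7)[OF scheme] by simp_all
  have inv_c: "inv c f \<in> F" if "f \<in> c ` F" for f
    using that by (auto simp: inv_f_f[OF c])
  show "\<forall>f\<in>c ` F. e (M (inv c f) D) \<in> e ` K\<^sub>0 \<and> (\<forall>p\<in>P. e (M (inv c f) p) \<in> e ` S)"
    using perfect_schemeD(8)[OF scheme] inv_c by blast
  show "e (M (inv c f) D) = e (M (inv c f') D)"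
    if "B \<in> \<Gamma>" "f \<in> c ` F" "f' \<in> c ` F" "\<forall>p\<in>B. e (M (inv c f) p) = e (M (inv c f') p)" for B f f'
    by (rule arg_cong[OF perfect_schemeD(9)[OF scheme, rule_format,
          OF that(1) inv_c[OF that(2)] inv_c[OF that(3)]]])
      (use that(4) injD[OF e] in blast)
  have card_eq: "card {g \<in> c ` F. e (M (inv c g) D) = e K \<and> (\<forall>p\<in>B. e (M (inv c g) p) = e (M f p))} =
      card {g \<in> F. M g D = K \<and> (\<forall>p\<in>B. M g p = M f p)}" for B f K
  proof -
    have "{g \<in> c ` F. e (M (inv c g) D) = e K \<and> (\<forall>p\<in>B. e (M (inv c g) p) = e (M f p))} =
        c ` {g \<in> F. M g D = K \<and> (\<forall>p\<in>B. M g p = M f p)}"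
      by (auto simp: inv_f_f[OF c] inj_eq[OF e])
    then show ?thesis
      using card_image[OF inj_on_subset[OF c subset_UNIV]] by simp
  qed
  show "card {g \<in> c ` F. e (M (inv c g) D) = K \<and> (\<forall>p\<in>B. e (M (inv c g) p) = e (M (inv c f) p))} =
      card {g \<in> c ` F. e (M (inv c g) D) = K' \<and> (\<forall>p\<in>B. e (M (inv c g) p) = e (M (inv c f) p))}"
    if "B \<subseteq> P" "B \<notin> \<Gamma>" "f \<in> c ` F" and keys: "K \<in> e ` K\<^sub>0" "K' \<in> e ` K\<^sub>0" for B f K K'
  proof -
    obtain x y where xy: "x \<in> K\<^sub>0" "K = e x" "y \<in> K\<^sub>0" "K' = e y"
      using keys by blast
    show ?thesis
      unfolding xy(2,4) card_eq
      by (rule perfect_schemeD(10)[OF scheme, rule_format, OF conjI[OF that(1,2)] inv_c[OF that(3)] xy(1,3)])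
  qed
qed

section \<open>The hierarchical access structure\<close>

text \<open>
  The sets of at least \<open>t\<close> participants that include an upper one.  This is the upward closure of the
  basis prescribed by the hierarchical model (\<open>hierarchical_model_hierarchical_structure\<close>).
\<close>

definition hierarchical_structure :: "nat \<Rightarrow> 'p set \<Rightarrow> 'p set \<Rightarrow> 'p set set" where
  "hierarchical_structure t U L = {A. A \<subseteq> U \<union> L \<and> t \<le> card A \<and> A \<inter> U \<noteq> {}}"

lemma subset_of_card_meeting:
  assumes "finite A" "1 \<le> t" "t \<le> card A" "A \<inter> U \<noteq> {}"
  obtains B where "B \<subseteq> A" "card B = t" "B \<inter> U \<noteq> {}"
proof -
  obtain u where u: "u \<in> A" "u \<in> U"
    using assms(4) by blast
  have "t - 1 \<le> card (A - {u})"
    using assms u by simp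
  then obtain C where C: "C \<subseteq> A - {u}" "card C = t - 1" "finite C"
    by (rule obtain_subset_with_card_n)
  have "card (insert u C) = t"
    using C assms(2) by (subst card_insert_disjoint) auto
  with that[of "insert u C"] C(1) u show thesis
    by blast
qed

lemma access_structure_hierarchical:
  assumes "finite (U \<union> L)"
  shows "access_structure (U \<union> L) (hierarchical_structure t U L)"
  using assms unfolding access_structure_def hierarchical_structure_def
  by (auto intro: order_trans[OF _ card_mono] dest: finite_subset)

lemma hierarchical_model_hierarchical_structure:
  assumes fin: "finite (U \<union> L)" and "U \<noteq> {}" "U \<inter> L = {}" "1 \<le> t"
  shows "hierarchical_model t U L (hierarchical_structure t U L)"
proof -
  let ?\<Gamma> = "hierarchical_structure t U L"
  have lower: "A \<subseteq> L \<longleftrightarrow> A \<inter> U = {}" if "A \<subseteq> U \<union> L" for A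
    using that assms(3) by blast
  have "basis ?\<Gamma> = {A. A \<subseteq> U \<union> L \<and> card A = t \<and> A \<inter> U \<noteq> {}}"
  proof (intro equalityI subsetI)
    fix A assume A: "A \<in> basis ?\<Gamma>"
    then have *: "A \<subseteq> U \<union> L" "t \<le> card A" "A \<inter> U \<noteq> {}"
      by (auto simp: basis_def hierarchical_structure_def)
    then obtain B where B: "B \<subseteq> A" "card B = t" "B \<inter> U \<noteq> {}"
      using subset_of_card_meeting[of A t U] finite_subset[OF _ fin] assms(4) by metis
    then have "B = A"
      using A * by (auto simp: basis_def hierarchical_structure_def)
    with B * show "A \<in> {A. A \<subseteq> U \<union> L \<and> card A = t \<and> A \<inter> U \<noteq> {}}"
      by simp
  next
    fix A assume "A \<in> {A. A \<subseteq> U \<union> L \<and> card A = t \<and> A \<inter> U \<noteq> {}}"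
    then have A: "A \<subseteq> U \<union> L" "card A = t" "A \<inter> U \<noteq> {}"
      by blast+
    have "B = A" if "B \<in> ?\<Gamma>" "B \<subseteq> A" for B
      using card_seteq[OF finite_subset[OF A(1) fin] that(2)] that(1) A(2)
      by (simp add: hierarchical_structure_def)
    with A show "A \<in> basis ?\<Gamma>"
      by (simp add: basis_def hierarchical_structure_def)
  qed
  moreover have "{A. A \<subseteq> U \<union> L \<and> card A = t \<and> A \<inter> U \<noteq> {}} =
      {A. A \<subseteq> U \<union> L \<and> card A = t} - {A. A \<subseteq> L \<and> card A = t}"
    using lower by blast
  ultimately show ?thesis
    unfolding hierarchical_model_def
    by (intro conjI assms(2,3) access_structure_hierarchical[OF fin]) simp
qed

text \<open>
  What remains to be checked about the vectors.  The minimal authorized sets must span the vector of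
  the dealer.  A set is unauthorized if it has fewer than \<open>t\<close> members or lies in \<open>L\<close>; in the latter case
  it suffices to consider \<open>L\<close> itself, as spans are monotone.
\<close>

lemma ideal_hierarchical_scheme_of_vectors:
  fixes w :: "'p \<Rightarrow> 'a::{field,finite} ^ 'n::finite"
  assumes fin: "finite (U \<union> L)" and "U \<noteq> {}" "U \<inter> L = {}" "1 \<le> t" and D: "D \<notin> U \<union> L"
    and spans: "\<And>B. B \<subseteq> U \<union> L \<Longrightarrow> card B = t \<Longrightarrow> B \<inter> U \<noteq> {} \<Longrightarrow> w D \<in> vec.span (w ` B)"
    and few: "\<And>B. B \<subseteq> U \<union> L \<Longrightarrow> card B < t \<Longrightarrow> w D \<notin> vec.span (w ` B)"
    and lower: "w D \<notin> vec.span (w ` L)"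
  shows "\<exists>\<Gamma> (K\<^sub>0 :: nat set) (S :: nat set) (F :: nat set) M.
    hierarchical_model t U L \<Gamma> \<and> ideal_scheme D (U \<union> L) \<Gamma> K\<^sub>0 S F M"
proof -
  let ?\<Gamma> = "hierarchical_structure t U L"
  let ?e = "to_nat :: 'a \<Rightarrow> nat" and ?c = "to_nat :: ('a ^ 'n \<Rightarrow> 'a) \<Rightarrow> nat"
  have spans_iff: "B \<in> ?\<Gamma> \<longleftrightarrow> w D \<in> vec.span (w ` B)" if B: "B \<subseteq> U \<union> L" for B
  proof
    assume "B \<in> ?\<Gamma>"
    then obtain C where C: "C \<subseteq> B" "card C = t" "C \<inter> U \<noteq> {}"
      using subset_of_card_meeting[of B t U] finite_subset[OF B fin] assms(4)
      unfolding hierarchical_structure_def by blast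
    then have "w D \<in> vec.span (w ` C)"
      using spans B by blast
    then show "w D \<in> vec.span (w ` B)"
      using vec.span_mono[OF image_mono[OF C(1)]] by blast
  next
    assume inspan: "w D \<in> vec.span (w ` B)"
    have "\<not> B \<subseteq> L"
      using inspan lower vec.span_mono[OF image_mono] by blast
    then show "B \<in> ?\<Gamma>"
      using inspan few[OF B] B unfolding hierarchical_structure_def by force
  qed
  have "perfect_scheme D (U \<union> L) ?\<Gamma> UNIV UNIV
      {f. Vector_Spaces.linear (*s) (*) f} (\<lambda>f p. f (w p))"
    by (rule linear_scheme_perfect[OF fin D access_structure_hierarchical[OF fin] spans_iff])
  then have perfect: "perfect_scheme D (U \<union> L) ?\<Gamma> (range ?e) (range ?e)
      (?c ` {f. Vector_Spaces.linear (*s) (*) f}) (\<lambda>f p. ?e (inv ?c f (w p)))"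
    by (rule perfect_scheme_relabel) simp_all
  have "card (range ?e) = CARD('a)"
    by (simp add: card_image)
  moreover have "card {0, 1 :: 'a} \<le> CARD('a)"
    by (rule card_mono) simp_all
  ultimately have "0 < log 2 (real (card (range ?e)))"
    by (subst zero_less_log_cancel_iff) auto
  then have "information_rate (range ?e) (range ?e) = 1"
    by (simp add: information_rate_def)
  with perfect have ideal: "ideal_scheme D (U \<union> L) ?\<Gamma> (range ?e) (range ?e)
      (?c ` {f. Vector_Spaces.linear (*s) (*) f}) (\<lambda>f p. ?e (inv ?c f (w p)))"
    unfolding ideal_scheme_def by (rule conjI)
  show ?thesis
    by (intro exI conjI) (rule hierarchical_model_hierarchical_structure[OF fin assms(2-4)] ideal)+
qed

section \<open>Vectors representing a hierarchical arc\<close>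

lemma proj_points_eq_span:
  assumes "P \<in> proj_points W" "x \<in> P" "x \<noteq> 0"
  shows "P = vec.span {x}"
proof -
  have P: "vec.subspace P" "vec.dim P = 1"
    using assms(1) by (auto simp: proj_points_def)
  show ?thesis
    using vec.card_eq_dim[of "{x}" P] P assms(2,3) vec.span_minimal[of "{x}" P] by auto
qed

lemma proj_points_nonzero_vector:
  assumes "P \<in> proj_points W"
  obtains x where "x \<in> P" "x \<noteq> 0"
proof -
  have "\<not> P \<subseteq> {0}"
    using assms vec.dim_eq_0[of P] by (auto simp: proj_points_def)
  with that show thesis
    by blast
qed

text \<open>
  The index \<open>i\<close> ranges over an enumeration of the points of the harc, and \<open>A\<close> is the set of indices of
  the points outside the hyperplane.
\<close>

lemma harc_vectors:
  fixes K :: "('a::{field,finite} ^ 'n::finite) set set"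
  assumes "harc k\<^sub>1 k\<^sub>2 K" and t: "CARD('n) = t"
  obtains A and w :: "nat \<Rightarrow> 'a ^ 'n" and \<Psi>
  where "A \<subseteq> {..<k\<^sub>1 + k\<^sub>2}" "card A = k\<^sub>1" "inj_on w {..<k\<^sub>1 + k\<^sub>2}" "vec.subspace \<Psi>"
    "\<And>i. i < k\<^sub>1 + k\<^sub>2 \<Longrightarrow> w i \<in> \<Psi> \<longleftrightarrow> i \<notin> A"
    "\<And>S. S \<subseteq> {..<k\<^sub>1 + k\<^sub>2} \<Longrightarrow> card S = t \<Longrightarrow> S \<inter> A \<noteq> {} \<Longrightarrow> vec.independent (w ` S)"
proof -
  obtain \<Psi> K\<^sub>1 K\<^sub>2 where H: "hyperplane \<Psi>" "K = K\<^sub>1 \<union> K\<^sub>2"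
      "K\<^sub>1 \<subseteq> proj_points UNIV - proj_points \<Psi>" "arc_in UNIV k\<^sub>1 K\<^sub>1" "arc_in \<Psi> k\<^sub>2 K\<^sub>2"
      "\<forall>S\<subseteq>K. card S = CARD('n) \<and> \<not> S \<subseteq> proj_points \<Psi> \<longrightarrow> indep_points S"
    using assms(1) unfolding harc_def by (elim exE conjE) (rule that)
  note K = H(2)
  have \<Psi>: "vec.subspace \<Psi>"
    using H(1) by (simp add: hyperplane_def)
  have K1: "K\<^sub>1 \<subseteq> proj_points UNIV - proj_points \<Psi>" "finite K\<^sub>1" "card K\<^sub>1 = k\<^sub>1"
    using H(3,4) by (simp_all add: arc_in_def)
  have K2: "K\<^sub>2 \<subseteq> proj_points \<Psi>" "finite K\<^sub>2" "card K\<^sub>2 = k\<^sub>2"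
    using H(5) by (simp_all add: arc_in_def)
  have indep: "indep_points S"
    if "S \<subseteq> K" "card S = CARD('n)" "\<not> S \<subseteq> proj_points \<Psi>" for S
    using H(6) that by blast
  have disj: "K\<^sub>1 \<inter> K\<^sub>2 = {}"
    using K1 K2 by blast
  have cardK: "card K = k\<^sub>1 + k\<^sub>2" "finite K"
    using K1 K2 K disj by (auto simp: card_Un_disjoint)
  have pts: "P \<in> proj_points UNIV" if "P \<in> K" for P
    using that K K1 K2 by (auto simp: proj_points_def)
  then have "\<forall>P\<in>K. \<exists>x. x \<in> P \<and> x \<noteq> 0"
    by (meson proj_points_nonzero_vector)
  then obtain v where v: "\<And>P. P \<in> K \<Longrightarrow> v P \<in> P" "\<And>P. P \<in> K \<Longrightarrow> v P \<noteq> 0"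
    by metis
  have span: "P = vec.span {v P}" if "P \<in> K" for P
    using proj_points_eq_span pts v that by blast
  have vinj: "inj_on v K"
    using span by (metis inj_onI)
  obtain h where h: "bij_betw h {..<k\<^sub>1 + k\<^sub>2} K"
    using ex_bij_betw_nat_finite[OF cardK(2)] cardK(1) by (auto simp: lessThan_atLeast0)
  let ?N = "{..<k\<^sub>1 + k\<^sub>2}"
  define A where "A = {i \<in> ?N. h i \<in> K\<^sub>1}"
  define w where "w = (\<lambda>i. v (h i))"
  have hinj: "inj_on h ?N" and him: "h ` ?N = K"
    using h by (auto simp: bij_betw_def)
  have winj: "inj_on w ?N"
    using comp_inj_on[OF hinj] vinj him by (simp add: w_def comp_def)
  have "h ` A = h ` ?N \<inter> K\<^sub>1"
    unfolding A_def by blast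
  then have "h ` A = K\<^sub>1"
    using him K by simp
  moreover have "A \<subseteq> ?N"
    by (auto simp: A_def)
  ultimately have cardA: "card A = k\<^sub>1"
    using K1(3) card_image[OF inj_on_subset[OF hinj]] by metis
  have in\<Psi>: "v P \<in> \<Psi> \<longleftrightarrow> P \<notin> K\<^sub>1" if P: "P \<in> K" for P
  proof
    assume "v P \<in> \<Psi>"
    then have "P \<subseteq> \<Psi>"
      using span[OF P] vec.span_minimal[of "{v P}" \<Psi>] \<Psi> by auto
    then show "P \<notin> K\<^sub>1"
      using K1(1) by (auto simp: proj_points_def)
  next
    assume "P \<notin> K\<^sub>1"
    then show "v P \<in> \<Psi>"
      using P K K2(1) v(1) by (auto simp: proj_points_def)
  qed
  have "vec.independent (w ` S)"
    if S: "S \<subseteq> ?N" "card S = t" "S \<inter> A \<noteq> {}" for S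
  proof -
    have "h ` S \<subseteq> K"
      using S(1) him by blast
    moreover have "card (h ` S) = CARD('n)"
      using S(2) t card_image[OF inj_on_subset[OF hinj S(1)]] by simp
    moreover have "\<not> h ` S \<subseteq> proj_points \<Psi>"
      using S(3) K1(1) by (auto simp: A_def)
    ultimately have "indep_points (h ` S)" "h ` S \<subseteq> K"
      using indep by blast+
    then have "vec.independent (v ` h ` S)"
      using v unfolding indep_points_def by blast
    then show ?thesis
      by (simp add: w_def image_image)
  qed
  moreover have "w i \<in> \<Psi> \<longleftrightarrow> i \<notin> A" if "i < k\<^sub>1 + k\<^sub>2" for i
    using in\<Psi>[of "h i"] that him by (auto simp: A_def w_def)
  ultimately show thesis
    using that[of A w \<Psi>] cardA winj \<Psi> by (auto simp: A_def)
qed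

section \<open>The scheme of a hierarchical arc\<close>

theorem theorem4p2:
  fixes q t k\<^sub>1 k\<^sub>2 :: nat
  assumes "primepow q" and "t \<ge> 2" and "k\<^sub>1 \<ge> 2"
    and "CARD('a::{field,finite}) = q" and "CARD('n::finite) = t"
    and "\<exists>K :: ('a ^ 'n) set set. harc k\<^sub>1 k\<^sub>2 K"
  shows "\<exists>(D :: nat) (U :: nat set) (L :: nat set) \<Gamma> (K\<^sub>0 :: nat set) (S :: nat set)
            (F :: nat set) (M :: nat \<Rightarrow> nat \<Rightarrow> nat).
           card (U \<union> L) = k\<^sub>1 + k\<^sub>2 - 1 \<and> hierarchical_model t U L \<Gamma> \<and>
           ideal_scheme D (U \<union> L) \<Gamma> K\<^sub>0 S F M"
proof (cases "k\<^sub>1 + k\<^sub>2 - 1 < t")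
  case True
  \<comment> \<open>There are no \<open>t\<close>-sets of participants, so all sets must be unauthorized: only the dealer \<open>?n\<close> gets
    a nonzero vector.  Placing everybody in the upper group is an arbitrary choice.\<close>
  let ?n = "k\<^sub>1 + k\<^sub>2 - 1"
  let ?w = "\<lambda>i. if i = ?n then 1 else 0 :: 'a ^ 'n"
  have zero: "vec.span (?w ` B) \<subseteq> {0}" if "B \<subseteq> {..<?n}" for B
    using that by (intro vec.span_minimal) auto
  have ex: "\<exists>\<Gamma> (K\<^sub>0 :: nat set) (S :: nat set) (F :: nat set) M.
    hierarchical_model t {..<?n} {} \<Gamma> \<and> ideal_scheme ?n ({..<?n} \<union> {}) \<Gamma> K\<^sub>0 S F M"
  proof (rule ideal_hierarchical_scheme_of_vectors[where w = ?w])
    show "?w ?n \<in> vec.span (?w ` B)" if "B \<subseteq> {..<?n} \<union> {}" "card B = t" for B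
      using card_mono[of "{..<?n}" B] that True by simp
    show "?w ?n \<notin> vec.span (?w ` B)" if "B \<subseteq> {..<?n} \<union> {}" for B
      using zero[of B] that by (auto simp: vec_eq_iff)
  qed (use assms(2,3) in \<open>auto simp: vec_eq_iff lessThan_empty_iff\<close>)
  have size: "card ({..<?n} \<union> {}) = ?n"
    by simp
  obtain \<Gamma> and K\<^sub>0 S F :: "nat set" and M
    where "hierarchical_model t {..<?n} {} \<Gamma>" "ideal_scheme ?n ({..<?n} \<union> {}) \<Gamma> K\<^sub>0 S F M"
    using ex by (elim exE conjE) (rule that)
  note scheme = size this
  show ?thesis
    by (intro exI conjI) (fact scheme)+
next
  case False
  let ?N = "{..<k\<^sub>1 + k\<^sub>2}"
  obtain K :: "('a ^ 'n) set set" where K: "harc k\<^sub>1 k\<^sub>2 K"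
    using assms(6) by (rule exE)
  obtain A and w :: "nat \<Rightarrow> 'a ^ 'n" and \<Psi> where A: "A \<subseteq> ?N" "card A = k\<^sub>1"
    and winj: "inj_on w ?N" and \<Psi>: "vec.subspace \<Psi>"
    and in\<Psi>: "\<And>i. i < k\<^sub>1 + k\<^sub>2 \<Longrightarrow> w i \<in> \<Psi> \<longleftrightarrow> i \<notin> A"
    and indep: "\<And>S. S \<subseteq> ?N \<Longrightarrow> card S = t \<Longrightarrow> S \<inter> A \<noteq> {} \<Longrightarrow> vec.independent (w ` S)"
    by (fact harc_vectors[OF K assms(5)])
  obtain D where D: "D \<in> A"
    using A assms(3) by fastforce
  define U L where "U = A - {D}" and "L = ?N - A"
  have UL: "U \<union> L = ?N - {D}"
    using A D by (auto simp: U_def L_def)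
  have "card U = k\<^sub>1 - 1"
    using A D unfolding U_def by simp
  then have "U \<noteq> {}"
    using assms(3) by auto
  have ex: "\<exists>\<Gamma> (K\<^sub>0 :: nat set) (S :: nat set) (F :: nat set) M.
    hierarchical_model t U L \<Gamma> \<and> ideal_scheme D (U \<union> L) \<Gamma> K\<^sub>0 S F M"
  proof (rule ideal_hierarchical_scheme_of_vectors[where w = w])
    show "w D \<in> vec.span (w ` B)" if B: "B \<subseteq> U \<union> L" "card B = t" "B \<inter> U \<noteq> {}" for B
    proof -
      have BN: "B \<subseteq> ?N"
        using B(1) UL by blast
      have "vec.independent (w ` B)"
        using indep[OF BN B(2)] B(3) U_def by blast
      moreover have "card (w ` B) = CARD('n)"
        using card_image[OF inj_on_subset[OF winj BN]] B(2) assms(5) by simp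
      ultimately have "UNIV \<subseteq> vec.span (w ` B)"
        by (intro vec.card_ge_dim_independent) (auto simp: vec.dim_UNIV card_cart_basis)
      then show ?thesis
        by blast
    qed
    show "w D \<notin> vec.span (w ` B)" if B: "B \<subseteq> U \<union> L" "card B < t" for B
    proof -
      have BN: "B \<subseteq> ?N - {D}"
        using B(1) UL by simp
      have "card (?N - {D}) = k\<^sub>1 + k\<^sub>2 - 1"
        using D A(1) by auto
      then have enough: "t - 1 \<le> card (?N - {D})"
        using False by simp
      have le: "card B \<le> t - 1"
        using B(2) by simp
      \<comment> \<open>\<open>B\<close> is padded to exactly \<open>t - 1\<close> participants, because the harc condition speaks only about
        sets of exactly \<open>t\<close> points.\<close>
      obtain C where C: "B \<subseteq> C" "C \<subseteq> ?N - {D}" "card C = t - 1"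
        using exists_subset_between[OF _ enough BN] le by auto
      have Cfin: "finite C"
        using C(2) finite_subset by blast
      have "card (insert D C) = t"
        using C Cfin assms(2) by (subst card_insert_disjoint) auto
      then have "vec.independent (w ` insert D C)"
        using indep[of "insert D C"] C(2) D A(1) by blast
      moreover have "w D \<notin> w ` C"
        using winj C(2) D A(1) by (auto dest: inj_onD)
      ultimately have "w D \<notin> vec.span (w ` C)"
        by (simp add: vec.independent_insert)
      then show ?thesis
        using vec.span_mono[OF image_mono[OF C(1)]] by blast
    qed
    have "vec.span (w ` L) \<subseteq> \<Psi>"
      using in\<Psi> \<Psi> by (intro vec.span_minimal) (auto simp: L_def)
    then show "w D \<notin> vec.span (w ` L)"
      using in\<Psi>[of D] D A(1) by blast
  qed (use \<open>U \<noteq> {}\<close> assms(2) UL in \<open>auto simp: U_def L_def\<close>)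
  have size: "card (U \<union> L) = k\<^sub>1 + k\<^sub>2 - 1"
    using UL D A(1) by auto
  obtain \<Gamma> and K\<^sub>0 S F :: "nat set" and M
    where "hierarchical_model t U L \<Gamma>" "ideal_scheme D (U \<union> L) \<Gamma> K\<^sub>0 S F M"
    using ex by (elim exE conjE) (rule that)
  note scheme = size this
  show ?thesis
    by (intro exI conjI) (fact scheme)+
qed

end
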